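(* For every integer $k\ge 2$ there exists an infinite sequence $(\mathcal{H}_i)_{i\ge 1}$ of $k$-uniform hypertrees, where $\mathcal{H}_i$ has $n_i$ vertices and $e_i$ edges, such that the sequence $(n_i)$ is strictly increasing and $e_i/\binom{n_i}{k-1}\to 1$ as $i\to\infty$.
   Context: A $k$-uniform hypergraph $\mathcal{H}=(V,\mathcal{E})$ consists of a finite vertex set $V$ and a set $\mathcal{E}$ of $k$-element subsets of $V$ (no multiple edges). A $k$-uniform hypergraph is a chain if there is a sequence $v_1,\dots,v_l$ of its vertices in which every vertex appears at least once (possibly more times), $v_1\ne v_l$, and its edge set consists of exactly the $l-k+1$ distinct sets $\{v_i,v_{i+1},\dots,v_{i+k-1}\}$, $1\le i\le l-k+1$. It is a semicycle if the same holds but with $v_1=v_l$ instead of $v_1\neq v_l$. The length of a chain or semicycle is its number of edges. $\mathcal{H}$ is chain-connected if every pair of distinct vertices is contained in some subhypergraph of $\mathcal{H}$ that is a chain; it is semicycle-free if no subhypergraph of $\mathcal{H}$ is a semicycle. A $k$-uniform hypertree is a $k$-uniform hypergraph that is chain-connected and semicycle-free. *)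

theory Defs
  imports Complex_Main
begin

datatype 'a hypergraph = Hypergraph (verts: "'a set") (edges: "'a set set")

definition uniform_hypergraph :: "nat \<Rightarrow> 'a hypergraph \<Rightarrow> bool" where
  "uniform_hypergraph k H \<longleftrightarrow>
     finite (verts H) \<and> (\<forall>e \<in> edges H. e \<subseteq> verts H \<and> card e = k)"

definition subhypergraph :: "'a hypergraph \<Rightarrow> 'a hypergraph \<Rightarrow> bool" where
  "subhypergraph H' H \<longleftrightarrow> verts H' \<subseteq> verts H \<and> edges H' \<subseteq> edges H"

definition window :: "nat \<Rightarrow> 'a list \<Rightarrow> nat \<Rightarrow> 'a set" where
  "window k vs i = (\<lambda>j. vs ! j) ` {i..<i + k}"

text \<open>
  With 0-based positions, a sequence of length \<open>l\<close> has the \<open>l - k + 1\<close> windows starting at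
  \<open>0, \<dots>, l - k\<close>. The condition \<open>k \<le> l\<close>, i.e. at least one edge, rules out degenerate sequences:
  otherwise a single vertex would be a semicycle without edges, and edgeless sets of at most
  \<open>k - 1\<close> vertices would be chains.
\<close>

definition traced_by :: "nat \<Rightarrow> 'a hypergraph \<Rightarrow> 'a list \<Rightarrow> bool" where
  "traced_by k H vs \<longleftrightarrow>
     k \<le> length vs \<and>
     set vs = verts H \<and>
     inj_on (window k vs) {0..length vs - k} \<and>
     edges H = window k vs ` {0..length vs - k}"

definition chain :: "nat \<Rightarrow> 'a hypergraph \<Rightarrow> bool" where
  "chain k H \<longleftrightarrow> uniform_hypergraph k H \<and> (\<exists>vs. traced_by k H vs \<and> hd vs \<noteq> last vs)"

definition semicycle :: "nat \<Rightarrow> 'a hypergraph \<Rightarrow> bool" where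
  "semicycle k H \<longleftrightarrow> uniform_hypergraph k H \<and> (\<exists>vs. traced_by k H vs \<and> hd vs = last vs)"

definition chain_connected :: "nat \<Rightarrow> 'a hypergraph \<Rightarrow> bool" where
  "chain_connected k H \<longleftrightarrow>
     (\<forall>x \<in> verts H. \<forall>y \<in> verts H. x \<noteq> y \<longrightarrow>
        (\<exists>C. subhypergraph C H \<and> chain k C \<and> x \<in> verts C \<and> y \<in> verts C))"

definition semicycle_free :: "nat \<Rightarrow> 'a hypergraph \<Rightarrow> bool" where
  "semicycle_free k H \<longleftrightarrow> \<not> (\<exists>C. subhypergraph C H \<and> semicycle k C)"

definition hypertree :: "nat \<Rightarrow> 'a hypergraph \<Rightarrow> bool" where
  "hypertree k H \<longleftrightarrow> uniform_hypergraph k H \<and> chain_connected k H \<and> semicycle_free k H"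

end

theory Submission
  imports Defs "HOL-Library.FuncSet"
begin

text \<open>
  For \<open>k = 2\<close> stars work. Let \<open>r = k - 1 \<ge> 2\<close>. Take \<open>M\<close> blocks of \<open>m = M ^ r\<close> vertices and a
  private apex for every set \<open>T\<close> of \<open>r\<close> blocks; the edges consist of the apex of some \<open>T\<close> and one
  vertex from each block in \<open>T\<close>. Edges with different apexes share fewer than \<open>r\<close> vertices, so a
  semicycle would keep its apex, which is impossible since the edges at an apex are \<open>k\<close>-partite
  with the apex alone in its part. Almost all \<open>r\<close>-sets of vertices are transversals, so the number
  of edges is asymptotically the number of \<open>r\<close>-sets. To gain chain-connectedness, add a
  set \<open>C\<close> of \<open>r\<close> new vertices and all edges \<open>insert v C\<close>. Any two vertices lie on a chain of at most
  two of these edges, at most two of them occur consecutively in a sequence, and they share at most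
  one vertex with the old edges.
\<close>


section \<open>Windows and closed sequences\<close>

lemma window_conv_insert_first:
  "window (Suc r) vs i = insert (vs ! i) ((\<lambda>j. vs ! j) ` {Suc i..<Suc i + r})"
proof -
  have "{i..<i + Suc r} = insert i {Suc i..<Suc i + r}" by auto
  then show ?thesis by (simp add: window_def)
qed

lemma window_conv_insert_last:
  "window (Suc r) vs i = insert (vs ! (i + r)) ((\<lambda>j. vs ! j) ` {i..<i + r})"
proof -
  have "{i..<i + Suc r} = insert (i + r) {i..<i + r}" by auto
  then show ?thesis by (simp add: window_def)
qed

lemma inj_on_window:
  assumes "card (window k vs i) = k"
  shows "inj_on (\<lambda>j. vs ! j) {i..<i + k}"
  using assms by (intro eq_card_imp_inj_on) (auto simp: window_def)

text \<open>The \<open>r\<close> shared positions carry distinct vertices, since the second window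
  has full cardinality.\<close>

lemma card_window_Int_Suc:
  assumes "card (window (Suc r) vs (Suc i)) = Suc r"
  shows "r \<le> card (window (Suc r) vs i \<inter> window (Suc r) vs (Suc i))"
proof -
  let ?I = "(\<lambda>j. vs ! j) ` {Suc i..<Suc i + r}"
  have "inj_on (\<lambda>j. vs ! j) {Suc i..<Suc i + r}"
    using inj_on_window[OF assms] by (rule inj_on_subset) auto
  then have "card ?I = r" by (simp add: card_image)
  moreover have "?I \<subseteq> window (Suc r) vs i \<inter> window (Suc r) vs (Suc i)"
    unfolding window_conv_insert_first[of r vs i] window_conv_insert_last[of r vs "Suc i"] by auto
  moreover have "finite (window (Suc r) vs i \<inter> window (Suc r) vs (Suc i))"
    by (simp add: window_def)
  ultimately show ?thesis by (metis card_mono)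
qed

text \<open>With \<open>k\<close> positions, both ends lie in one window, whose entries are
  distinct. With \<open>k + 1\<close> positions, the two windows share all inner positions and their
  remaining vertices, the two ends, are equal, so the windows coincide.\<close>

lemma semicycle_length:
  assumes "traced_by k C vs" "uniform_hypergraph k C" "hd vs = last vs" "k \<ge> 2"
  shows "k + 2 \<le> length vs"
proof (rule ccontr)
  assume short: "\<not> ?thesis"
  have len: "k \<le> length vs" and inj: "inj_on (window k vs) {0..length vs - k}"
    and edg: "edges C = window k vs ` {0..length vs - k}"
    using assms(1) by (auto simp: traced_by_def)
  have "vs \<noteq> []" using len assms(4) by auto
  then have ends: "vs ! 0 = vs ! (length vs - 1)"
    using assms(3) by (simp add: hd_conv_nth last_conv_nth)
  have card: "card (window k vs 0) = k"
    using assms(2) edg by (auto simp: uniform_hypergraph_def)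
  obtain r where r: "k = Suc r" using assms(4) by (cases k) auto
  consider "length vs = k" | "length vs = Suc k" using short len by linarith
  then show False
  proof cases
    case 1
    have "0 = length vs - 1"
      by (rule inj_onD[OF inj_on_window[OF card] ends]) (use 1 assms(4) in auto)
    then show False using 1 assms(4) by simp
  next
    case 2
    have "window k vs 0 = window k vs 1"
      using window_conv_insert_first[of r vs 0] window_conv_insert_last[of r vs "Suc 0"] ends 2 r
      by simp
    then have "(0::nat) = 1" by (rule inj_onD[OF inj]) (use 2 in auto)
    then show False by simp
  qed
qed

text \<open>Trades the subhypergraph for its sequence, which is closed and has at least three
  windows, all of them edges.\<close>

lemma semicycle_freeI:
  assumes "k \<ge> 2"
    and "\<And>vs. \<lbrakk>k + 2 \<le> length vs; vs ! 0 = vs ! (length vs - 1);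
          inj_on (window k vs) {0..length vs - k};
          \<And>i. i + k \<le> length vs \<Longrightarrow> window k vs i \<in> E \<and> card (window k vs i) = k\<rbrakk> \<Longrightarrow> False"
  shows "semicycle_free k (Hypergraph V E)"
proof -
  have False if sub: "subhypergraph C (Hypergraph V E)" and sc: "semicycle k C" for C
  proof -
    obtain vs where uni: "uniform_hypergraph k C" and tr: "traced_by k C vs" and hl: "hd vs = last vs"
      using sc by (auto simp: semicycle_def)
    have len: "k + 2 \<le> length vs" by (rule semicycle_length[OF tr uni hl assms(1)])
    have "vs \<noteq> []" using len by auto
    then have "vs ! 0 = vs ! (length vs - 1)"
      using hl by (simp add: hd_conv_nth last_conv_nth)
    moreover have "window k vs i \<in> E \<and> card (window k vs i) = k" if "i + k \<le> length vs" for i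
    proof -
      have "window k vs i \<in> edges C"
        using tr that by (auto simp: traced_by_def)
      then show ?thesis using sub uni by (auto simp: subhypergraph_def uniform_hypergraph_def)
    qed
    ultimately show False using assms(2)[OF len] tr by (auto simp: traced_by_def)
  qed
  then show ?thesis by (auto simp: semicycle_free_def)
qed

section \<open>Gluing semicycle-free families\<close>

text \<open>Consecutive windows share \<open>k - 1\<close> vertices, so a semicycle cannot change its part.\<close>

lemma semicycle_free_Union:
  assumes k: "k \<ge> 2"
    and free: "\<And>j. j \<in> J \<Longrightarrow> semicycle_free k (Hypergraph V (F j))"
    and sep: "\<And>i j e f. \<lbrakk>i \<in> J; j \<in> J; e \<in> F i; f \<in> F j; k - 1 \<le> card (e \<inter> f)\<rbrakk> \<Longrightarrow> i = j"
  shows "semicycle_free k (Hypergraph V (\<Union>j\<in>J. F j))"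
proof -
  have False if sub: "subhypergraph C (Hypergraph V (\<Union>j\<in>J. F j))" and sc: "semicycle k C" for C
  proof -
    obtain vs where uni: "uniform_hypergraph k C" and tr: "traced_by k C vs"
      using sc by (auto simp: semicycle_def)
    obtain r where r: "k = Suc r" using k by (cases k) auto
    have win: "window k vs i \<in> edges C" if "i \<le> length vs - k" for i
      using tr that by (auto simp: traced_by_def)
    obtain j where j: "j \<in> J" "window k vs 0 \<in> F j"
      using win[of 0] sub by (auto simp: subhypergraph_def)
    have "window k vs i \<in> F j" if "i \<le> length vs - k" for i
      using that
    proof (induction i)
      case 0
      show ?case by (rule j)
    next
      case (Suc i)
      obtain j' where j': "j' \<in> J" "window k vs (Suc i) \<in> F j'"
        using win[OF Suc.prems] sub by (auto simp: subhypergraph_def)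
      have "card (window k vs (Suc i)) = k"
        using win[OF Suc.prems] uni by (auto simp: uniform_hypergraph_def)
      then have "k - 1 \<le> card (window k vs i \<inter> window k vs (Suc i))"
        using card_window_Int_Suc[of r vs i] by (simp add: r)
      then have "j = j'" using sep j(1) j' Suc by (meson Suc_leD)
      then show ?case using j' by simp
    qed
    then have "edges C \<subseteq> F j" using tr by (auto simp: traced_by_def)
    then have "subhypergraph C (Hypergraph V (F j))" using sub by (auto simp: subhypergraph_def)
    then show False using free[OF j(1)] sc by (auto simp: semicycle_free_def)
  qed
  then show ?thesis by (auto simp: semicycle_free_def)
qed

section \<open>Sunflowers with one-point petals\<close>

definition sunflower :: "'a set \<Rightarrow> 'a set \<Rightarrow> 'a set set" where
  "sunflower V C = (\<lambda>v. insert v C) ` (V - C)"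

lemma card_sunflower:
  assumes "finite V" "C \<subseteq> V"
  shows "card (sunflower V C) = card V - card C"
proof -
  have "inj_on (\<lambda>v. insert v C) (V - C)" by (rule inj_onI) blast
  then show ?thesis
    unfolding sunflower_def using assms by (simp add: card_image card_Diff_subset finite_subset)
qed

text \<open>Two distinct edges meet exactly in \<open>C\<close>, so the \<open>k - 1\<close>
  positions shared by consecutive windows carry exactly \<open>C\<close>. With three windows, the
  vertex at position 1 would occur again at some position from 2 to \<open>k\<close>, inside the
  window starting at 1.\<close>

lemma semicycle_free_sunflower:
  assumes C: "finite C" "card C = k - 1" and k: "k \<ge> 2"
  shows "semicycle_free k (Hypergraph V (sunflower V C))"
proof (rule semicycle_freeI[OF k])
  fix vs :: "'a list"
  assume len: "k + 2 \<le> length vs" and inj: "inj_on (window k vs) {0..length vs - k}"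
    and win: "\<And>i. i + k \<le> length vs \<Longrightarrow> window k vs i \<in> sunflower V C \<and> card (window k vs i) = k"
  obtain r where r: "k = Suc r" using k by (cases k) auto
  have core: "C = (\<lambda>j. vs ! j) ` {Suc i..<Suc i + r}" if i: "Suc i + k \<le> length vs" for i
  proof -
    let ?I = "(\<lambda>j. vs ! j) ` {Suc i..<Suc i + r}"
    obtain a b where ab: "window k vs i = insert a C" "window k vs (Suc i) = insert b C"
      using win[of i] win[of "Suc i"] i by (auto simp: sunflower_def)
    have "window k vs i \<noteq> window k vs (Suc i)"
      using inj_onD[OF inj, of i "Suc i"] i by (auto simp: le_diff_conv2)
    then have "window k vs i \<inter> window k vs (Suc i) = C" using ab by auto
    then have sub: "?I \<subseteq> C"
      unfolding r window_conv_insert_first[of r vs i] window_conv_insert_last[of r vs "Suc i"] by auto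
    have "inj_on (\<lambda>j. vs ! j) {Suc i..<Suc i + r}"
      by (rule inj_on_subset[OF inj_on_window[of k vs i]]) (use win[of i] i r in auto)
    then have "card ?I = card C" using C r by (simp add: card_image)
    then show ?thesis using sub C(1) card_subset_eq by blast
  qed
  have "vs ! 1 \<in> C" using core[of 0] len r k by auto
  then have "vs ! 1 \<in> (\<lambda>j. vs ! j) ` {2..<2 + r}" using core[of 1] len by (auto simp: numeral_2_eq_2)
  then obtain j where j: "2 \<le> j" "j < 2 + r" "vs ! 1 = vs ! j" by auto
  have "1 = j"
    by (rule inj_onD[OF inj_on_window[of k vs 1] j(3)]) (use win[of 1] len j r in auto)
  then show False using j by simp
qed

text \<open>If one of the two vertices lies in the core, a single edge contains both; otherwise two
  edges through the core form the chain.\<close>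

lemma chain_connected_sunflower:
  assumes V: "finite V" "C \<subset> V" and C: "card C = k - 1" and k: "k \<ge> 2"
    and sub: "sunflower V C \<subseteq> E"
  shows "chain_connected k (Hypergraph V E)"
  unfolding chain_connected_def
proof (intro ballI impI)
  fix x y assume "x \<in> verts (Hypergraph V E)" "y \<in> verts (Hypergraph V E)" and ne: "x \<noteq> y"
  then have xy: "x \<in> V" "y \<in> V" by auto
  have finC: "finite C" using V finite_subset by blast
  let ?joined = "\<exists>D. subhypergraph D (Hypergraph V E) \<and> chain k D \<and> x \<in> verts D \<and> y \<in> verts D"
  have in_edge: ?joined if e: "e \<in> sunflower V C" "x \<in> e" "y \<in> e" for e
  proof -
    have fe: "finite e" "card e = k" "e \<subseteq> V"
      using e(1) V finC C k by (auto simp: sunflower_def)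
    obtain vs where vs: "set vs = e" "distinct vs" using finite_distinct_list[OF fe(1)] by blast
    have len: "length vs = k" using vs fe distinct_card by metis
    have w: "window k vs 0 = e" unfolding window_def vs(1)[symmetric] len[symmetric]
      by (auto simp: in_set_conv_nth)
    have "hd vs \<noteq> last vs" using vs(2) len k
      by (cases vs; cases "tl vs" rule: rev_cases) auto
    moreover have "traced_by k (Hypergraph e {e}) vs"
      using vs len w by (auto simp: traced_by_def)
    ultimately have "chain k (Hypergraph e {e})"
      using fe by (auto simp: chain_def uniform_hypergraph_def)
    then show ?joined using e fe sub
      by (intro exI[of _ "Hypergraph e {e}"]) (auto simp: subhypergraph_def)
  qed
  \<comment> \<open>A petal for the case that both vertices lie in the core.\<close>
  obtain v where v: "v \<in> V" "v \<notin> C" using V by blast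
  consider "x \<in> C" "y \<in> C" | "x \<notin> C" "y \<in> C" | "x \<in> C" "y \<notin> C" | "x \<notin> C" "y \<notin> C" by blast
  then show ?joined
  proof cases
    case 1
    show ?joined by (rule in_edge[of "insert v C"]) (use 1 v in \<open>auto simp: sunflower_def\<close>)
  next
    case 2
    show ?joined by (rule in_edge[of "insert x C"]) (use 2 xy in \<open>auto simp: sunflower_def\<close>)
  next
    case 3
    show ?joined by (rule in_edge[of "insert y C"]) (use 3 xy in \<open>auto simp: sunflower_def\<close>)
  next
    case 4
    obtain cs where cs: "set cs = C" "distinct cs" using finite_distinct_list[OF finC] by blast
    have len: "length cs = k - 1" using cs C distinct_card by metis
    \<comment> \<open>With the core listed in between, the two windows are \<open>insert x C\<close>
      and \<open>insert y C\<close>.\<close>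
    define vs where "vs = x # cs @ [y]"
    have C_eq: "(\<lambda>j. vs ! j) ` {Suc 0..<k} = C"
    proof -
      have "{Suc 0..<k} = Suc ` {0..<k - 1}" using k by simp
      then have "(\<lambda>j. vs ! j) ` {Suc 0..<k} = (\<lambda>j. vs ! Suc j) ` {0..<k - 1}"
        by (simp add: image_image del: image_Suc_atLeastLessThan)
      also have "\<dots> = (\<lambda>j. cs ! j) ` {0..<k - 1}"
        by (rule image_cong) (auto simp: vs_def nth_append len)
      also have "\<dots> = C" using cs(1) len by (auto simp: in_set_conv_nth)
      finally show ?thesis .
    qed
    have y: "vs ! k = y" using len k by (auto simp: vs_def nth_append nth_Cons')
    obtain r where r: "k = Suc r" using k by (cases k) auto
    have w0: "window k vs 0 = insert x C"
      using window_conv_insert_first[of r vs 0] C_eq r by (simp add: vs_def)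
    have w1: "window k vs (Suc 0) = insert y C"
      using window_conv_insert_last[of r vs "Suc 0"] C_eq r y by simp
    let ?D = "Hypergraph (insert x (insert y C)) {insert x C, insert y C}"
    have lv: "length vs = Suc k" using len k by (simp add: vs_def)
    have ix: "{0..length vs - k} = {0, Suc 0}" unfolding lv by auto
    have "insert x C \<noteq> insert y C" using 4 ne by blast
    then have "traced_by k ?D vs"
      unfolding traced_by_def ix using lv cs w0 w1 by (auto simp: vs_def)
    moreover have "hd vs \<noteq> last vs" using ne by (simp add: vs_def)
    moreover have "uniform_hypergraph k ?D"
      using finC 4 C k by (auto simp: uniform_hypergraph_def)
    ultimately have "chain k ?D" by (auto simp: chain_def)
    moreover have "subhypergraph ?D (Hypergraph V E)"
      using xy V sub 4 by (auto simp: subhypergraph_def sunflower_def)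
    ultimately show ?joined by (intro exI[of _ ?D]) auto
  qed
qed

section \<open>Partite families with a common vertex\<close>

text \<open>Along a semicycle the colours have period \<open>k\<close>. As \<open>x\<close> cannot recur after \<open>k\<close> steps, the
  positions of the two ends differ by more than \<open>k\<close> but less than \<open>2 * k\<close>, so the ends have
  different colours.\<close>

lemma semicycle_free_partite:
  assumes k: "k \<ge> 2"
    and inj: "\<And>e. e \<in> E \<Longrightarrow> inj_on c e"
    and img: "\<And>e. e \<in> E \<Longrightarrow> c ` e = P"
    and x: "\<And>e. e \<in> E \<Longrightarrow> x \<in> e"
    and x_class: "\<And>e v. \<lbrakk>e \<in> E; v \<in> e; c v = c x\<rbrakk> \<Longrightarrow> v = x"
  shows "semicycle_free k (Hypergraph V E)"
proof (rule semicycle_freeI[OF k])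
  fix vs :: "'a list"
  assume len: "k + 2 \<le> length vs" and ends: "vs ! 0 = vs ! (length vs - 1)"
    and injw: "inj_on (window k vs) {0..length vs - k}"
    and win: "\<And>i. i + k \<le> length vs \<Longrightarrow> window k vs i \<in> E \<and> card (window k vs i) = k"
  obtain r where r: "k = Suc r" using k by (cases k) auto
  have mem: "vs ! j \<in> window k vs i" if "i \<le> j" "j < i + k" for i j
    using that by (auto simp: window_def)
  \<comment> \<open>Both windows have the colour set \<open>P\<close>. The vertex that is dropped
    has the only colour missing from the shared positions, so the vertex that is added must have it
    too.\<close>
  have period: "c (vs ! (i + k)) = c (vs ! i)" if i: "i + k < length vs" for i
  proof -
    let ?I = "(\<lambda>j. vs ! j) ` {Suc i..<Suc i + r}"
    have 1: "window k vs i = insert (vs ! i) ?I" by (simp add: r window_conv_insert_first)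
    have 2: "window k vs (Suc i) = insert (vs ! (i + k)) ?I" by (simp add: r window_conv_insert_last)
    have E: "window k vs i \<in> E" "window k vs (Suc i) \<in> E" using win i by auto
    have "vs ! i \<notin> ?I"
    proof
      assume "vs ! i \<in> ?I"
      then have "window k vs i = ?I" using 1 by auto
      then have "card (window k vs i) \<le> r" by (metis card_atLeastLessThan card_image_le diff_add_inverse finite_atLeastLessThan)
      then show False using win[of i] i r by auto
    qed
    then have ni: "c (vs ! i) \<notin> c ` ?I" using inj[OF E(1)] 1 by (auto simp: inj_on_def)
    have "c ` window k vs i = c ` window k vs (Suc i)"
      using img[OF E(1)] img[OF E(2)] by (rule trans[OF _ sym])
    then have "insert (c (vs ! i)) (c ` ?I) = insert (c (vs ! (i + k))) (c ` ?I)"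
      unfolding 1 2 image_insert .
    then show ?thesis using ni by (metis insertE insertI1)
  qed
  have "x \<in> window k vs 0" using x win[of 0] len by auto
  then obtain p where p: "p < k" "vs ! p = x" by (auto simp: window_def)
  have short: "length vs \<le> p + k"
  proof (rule ccontr)
    assume "\<not> ?thesis"
    then have l: "p + k < length vs" by simp
    \<comment> \<open>By periodicity this vertex has the colour of \<open>x\<close>. Dropping
      \<open>x\<close> and adding it again repeats a window.\<close>
    have "vs ! (p + k) = x"
      by (rule x_class[of "window k vs (Suc p)"]) (use l win[of "Suc p"] mem[of "Suc p" "p + k"] k period[OF l] p in auto)
    then have "window k vs p = window k vs (Suc p)"
      using p by (simp add: r window_conv_insert_first[of r vs p] window_conv_insert_last[of r vs "Suc p"])
    then have "p = Suc p" by (rule inj_onD[OF injw]) (use l in auto)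
    then show False by simp
  qed
  \<comment> \<open>The last position shifted down by one period, which brings it into the first
    window.\<close>
  define q where "q = length vs - 1 - k"
  have q: "0 < q" "q < k" "length vs - 1 = q + k" using len short p by (auto simp: q_def)
  have "c (vs ! 0) = c (vs ! q)" using period[of q] ends q len by auto
  moreover have "window k vs 0 \<in> E" using win[of 0] len by auto
  ultimately have "vs ! 0 = vs ! q"
    using inj_onD[OF inj] mem[of 0 0] mem[of 0 q] q k by simp
  moreover have "card (window k vs 0) = k" using win[of 0] len by auto
  ultimately have "0 = q"
    using inj_onD[OF inj_on_window] q k by fastforce
  then show False using q by simp
qed

section \<open>Transversals and the cones over them\<close>

text \<open>The vertices below \<open>M * m\<close> form \<open>M\<close> blocks of \<open>m\<close> vertices, the residue classes modulo \<open>M\<close>.\<close>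

definition transversals :: "nat \<Rightarrow> nat \<Rightarrow> nat set \<Rightarrow> nat set set" where
  "transversals M m T = (\<lambda>f. (\<lambda>j. f j * M + j) ` T) ` (T \<rightarrow>\<^sub>E {..<m})"

lemma transversalsD:
  assumes T: "T \<subseteq> {..<M}" and S: "S \<in> transversals M m T"
  shows "S \<subseteq> {..<M * m}" "(\<lambda>v. v mod M) ` S = T" "inj_on (\<lambda>v. v mod M) S" "finite S" "card S = card T"
proof -
  obtain f where f: "f \<in> T \<rightarrow>\<^sub>E {..<m}" "S = (\<lambda>j. f j * M + j) ` T"
    using S by (auto simp: transversals_def)
  have md: "(f j * M + j) mod M = j" if "j \<in> T" for j using that T by auto
  show "S \<subseteq> {..<M * m}"
  proof
    fix v assume "v \<in> S"
    then obtain j where j: "j \<in> T" "v = f j * M + j" using f by auto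
    \<comment> \<open>Hence \<open>f j * M + j < Suc (f j) * M\<close>, which is at most
      \<open>m * M\<close>.\<close>
    have "Suc (f j) * M \<le> m * M" by (rule mult_le_mono1) (use PiE_mem[OF f(1) j(1)] in simp)
    moreover have "j < M" using j T by auto
    ultimately show "v \<in> {..<M * m}" using j by (simp add: mult.commute)
  qed
  show img: "(\<lambda>v. v mod M) ` S = T" using md by (auto simp: f(2) image_image)
  show inj: "inj_on (\<lambda>v. v mod M) S" unfolding f(2)
    by (intro inj_on_imageI inj_onI) (metis comp_apply md)
  show "finite S" using f(2) T finite_subset by blast
  show "card S = card T" using card_image[OF inj] img by simp
qed

text \<open>The residue of an element gives its block \<open>j\<close>, and its quotient by
  \<open>M\<close> then gives \<open>f j\<close>; so the set determines the choice function.\<close>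

lemma card_transversals:
  assumes T: "T \<subseteq> {..<M}"
  shows "card (transversals M m T) = m ^ card T"
proof -
  have fin: "finite T" using T finite_subset by blast
  have "inj_on (\<lambda>f. (\<lambda>j. f j * M + j) ` T) (T \<rightarrow>\<^sub>E {..<m})"
  proof (rule inj_onI)
    fix f g assume f: "f \<in> T \<rightarrow>\<^sub>E {..<m}" and g: "g \<in> T \<rightarrow>\<^sub>E {..<m}"
      and eq: "(\<lambda>j. f j * M + j) ` T = (\<lambda>j. g j * M + j) ` T"
    have "f j = g j" if j: "j \<in> T" for j
    proof -
      have "f j * M + j \<in> (\<lambda>j. g j * M + j) ` T" using eq j by blast
      then obtain j' where j': "j' \<in> T" "f j * M + j = g j' * M + j'" by auto
      have "j < M" "j' < M" using j j' T by auto
      then have "j = j'" using j'(2) by (metis mod_less mod_mult_self3)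
      then show ?thesis using j'(2) \<open>j < M\<close> by simp
    qed
    then show "f = g" by (rule PiE_ext[OF f g])
  qed
  then show ?thesis
    unfolding transversals_def using fin by (simp add: card_image card_PiE)
qed

text \<open>Colour vertices by their residue and the apex by \<open>M\<close>, which is not a
  residue; every edge then has the colours \<open>insert M T\<close>.\<close>

lemma semicycle_free_cone_transversals:
  assumes k: "k \<ge> 2" and T: "T \<subseteq> {..<M}" and a: "M * m \<le> a"
  shows "semicycle_free k (Hypergraph V (insert a ` transversals M m T))"
proof (rule semicycle_free_partite[where x = a and P = "insert M T"
      and c = "\<lambda>v. if v = a then M else v mod M", OF k])
  fix e assume "e \<in> insert a ` transversals M m T"
  then obtain S where e: "e = insert a S" and S: "S \<in> transversals M m T" by auto
  note S = transversalsD[OF T S]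
  let ?c = "\<lambda>v. if v = a then M else v mod M"
  have aS: "a \<notin> S" using S(1) a by auto
  have cS: "?c v = v mod M" if "v \<in> S" for v using that aS by auto
  have lt: "v mod M < M" if "v \<in> S" for v using that S(2) T by auto
  show "inj_on ?c e"
    using S(3) aS lt unfolding e inj_on_def by (metis (mono_tags, lifting) insertE less_irrefl)
  have "?c ` S = (\<lambda>v. v mod M) ` S" by (rule image_cong) (use cS in auto)
  then have "?c ` S = T" using S(2) by simp
  then show "?c ` e = insert M T" unfolding e image_insert by simp
  show "a \<in> e" unfolding e by simp
  show "v = a" if "v \<in> e" "?c v = ?c a" for v
    using that lt unfolding e by (metis insertE less_irrefl)
qed

section \<open>Construction of the hypertrees\<close>

text \<open>The summands count the block vertices, the apexes and the core of the sunflower.\<close>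

definition tree_order :: "nat \<Rightarrow> nat \<Rightarrow> nat" where
  "tree_order r M = M * M ^ r + (M choose r) + r"

lemma exists_hypertree:
  fixes r M :: nat
  assumes r: "r \<ge> 2" and M: "M \<ge> 1"
  defines "n \<equiv> tree_order r M"
  shows "\<exists>H :: nat hypergraph. hypertree (Suc r) H \<and> card (verts H) = n \<and>
           card (edges H) = (M choose r) * (M ^ r) ^ r + (n - r)"
proof -
  \<comment> \<open>Blocks of this size make the at most \<open>M ^ r\<close> apexes negligible
    among the vertices.\<close>
  define m where "m = M ^ r"
  define N where "N = M choose r"
  have n: "n = M * m + N + r" by (simp add: n_def tree_order_def m_def N_def)
  define Ts where "Ts = {T. T \<subseteq> {..<M} \<and> card T = r}"
  have Ts: "finite Ts" "card Ts = N"
    using n_subsets[of "{..<M}" r] by (auto simp: Ts_def N_def)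
  have "\<exists>ap. bij_betw ap Ts {M * m..<M * m + N}"
    by (rule finite_same_card_bij) (use Ts in auto)
  then obtain ap where ap: "bij_betw ap Ts {M * m..<M * m + N}" by blast
  have inj_ap: "inj_on ap Ts" using ap by (rule bij_betw_imp_inj_on)
  have ap_range: "M * m \<le> ap T" "ap T < M * m + N" if "T \<in> Ts" for T
    using bij_betwE[OF ap] that by auto
  define V where "V = {..<n}"
  define C where "C = {M * m + N..<n}"
  have C: "C \<subset> V" "finite C" "card C = r"
    \<comment> \<open>Vertex 0 lies in a block, so the core is a proper subset.\<close>
    using M unfolding C_def V_def n m_def by (auto simp: psubset_eq set_eq_iff intro!: exI[of _ 0])
  define F where "F T = insert (ap T) ` transversals M m T" for T
  have F_edge: "e \<subseteq> {..<M * m + N} \<and> card e = Suc r \<and> ap T \<in> e \<and> (\<lambda>v. v mod M) ` (e - {ap T}) = T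
      \<and> e - {ap T} \<subseteq> {..<M * m}"
    if "T \<in> Ts" "e \<in> F T" for T e
  proof -
    obtain S where S: "S \<in> transversals M m T" "e = insert (ap T) S" using \<open>e \<in> F T\<close> by (auto simp: F_def)
    have T: "T \<subseteq> {..<M}" "card T = r" using \<open>T \<in> Ts\<close> by (auto simp: Ts_def)
    note S' = transversalsD[OF T(1) S(1)]
    have "ap T \<notin> S" using S'(1) ap_range[OF \<open>T \<in> Ts\<close>] by auto
    then show ?thesis using S' S(2) T ap_range[OF \<open>T \<in> Ts\<close>] by auto
  qed
  \<comment> \<open>Different sets have different apexes, and neither apex is a common vertex. So
    \<open>r\<close> common vertices would make up both edges without their apexes, and the residues
    of these vertices recover both \<open>T\<close> and \<open>T'\<close>.\<close>
  have F_sep: "T = T'" if T: "T \<in> Ts" "e \<in> F T" and T': "T' \<in> Ts" "e' \<in> F T'"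
    and big: "r \<le> card (e \<inter> e')" for T T' e e'
  proof (rule ccontr)
    assume ne: "T \<noteq> T'"
    then have "ap T \<noteq> ap T'" using inj_ap T T' by (auto dest: inj_onD)
    note e = F_edge[OF T] and e' = F_edge[OF T']
    let ?S = "e - {ap T}" and ?S' = "e' - {ap T'}"
    have "e \<inter> e' \<subseteq> ?S" "e \<inter> e' \<subseteq> ?S'"
      using e e' ap_range[OF T(1)] ap_range[OF T'(1)] \<open>ap T \<noteq> ap T'\<close> by auto
    moreover have "finite e" "finite e'" using e e' by (auto intro: finite_subset)
    moreover have "card ?S = r" "card ?S' = r" using e e' \<open>finite e\<close> \<open>finite e'\<close> by auto
    ultimately have "e \<inter> e' = ?S" "e \<inter> e' = ?S'" using big
      by (metis card_seteq finite_Diff)+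
    then show False using e e' ne by metis
  qed
  have F_card: "card (F T) = m ^ r" if "T \<in> Ts" for T
  proof -
    have T: "T \<subseteq> {..<M}" "card T = r" using that by (auto simp: Ts_def)
    have "inj_on (insert (ap T)) (transversals M m T)"
    proof (rule inj_onI)
      fix S S' assume S: "S \<in> transversals M m T" "S' \<in> transversals M m T"
        and eq: "insert (ap T) S = insert (ap T) S'"
      have "ap T \<notin> S" "ap T \<notin> S'"
        using transversalsD(1)[OF T(1) S(1)] transversalsD(1)[OF T(1) S(2)] ap_range[OF that] by auto
      then show "S = S'" using eq by (metis insert_ident)
    qed
    then show ?thesis unfolding F_def using card_transversals[OF T(1)] T(2) by (simp add: card_image)
  qed
  define E where "E = (\<Union>T\<in>Ts. F T)"
  have E_edge: "e \<subseteq> {..<M * m + N} \<and> card e = Suc r" if "e \<in> E" for e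
    using that F_edge unfolding E_def by blast
  have fin_F: "finite (F T)" if "T \<in> Ts" for T
  proof (rule finite_subset)
    show "F T \<subseteq> Pow {..<M * m + N}" using F_edge[OF that] by blast
  qed simp
  have F_disj: "F T \<inter> F T' = {}" if "T \<in> Ts" "T' \<in> Ts" "T \<noteq> T'" for T T'
  proof -
    have "T = T'" if "e \<in> F T" "e \<in> F T'" for e
      by (rule F_sep[OF \<open>T \<in> Ts\<close> that(1) \<open>T' \<in> Ts\<close> that(2)]) (use F_edge[OF \<open>T \<in> Ts\<close> that(1)] in simp)
    then show ?thesis using that(3) by blast
  qed
  have "card E = (\<Sum>T\<in>Ts. card (F T))"
    unfolding E_def using Ts(1) fin_F F_disj by (intro card_UN_disjoint) auto
  also have "\<dots> = N * m ^ r" using F_card Ts(2) by simp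
  finally have card_E: "card E = N * m ^ r" .
  have fin_E: "finite E" unfolding E_def using Ts(1) fin_F by blast
  let ?S = "sunflower V C"
  have S_edge: "e \<subseteq> V \<and> card e = Suc r" if "e \<in> ?S" for e
    using that C by (auto simp: sunflower_def)
  \<comment> \<open>Edges in \<open>E\<close> avoid the core, so only the petal can be shared; here
    \<open>1 < r\<close> enters.\<close>
  have ES: "card (e \<inter> f) < r" if e: "e \<in> E" and f: "f \<in> ?S" for e f
  proof -
    obtain v where v: "f = insert v C" using f by (auto simp: sunflower_def)
    have "e \<inter> C = {}" using E_edge[OF e] by (auto simp: C_def)
    then have "e \<inter> f \<subseteq> {v}" using v by auto
    then have "card (e \<inter> f) \<le> 1" using card_mono[of "{v}"] by simp
    then show ?thesis using r by simp
  qed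
  let ?H = "Hypergraph V (E \<union> ?S)"
  have free_E: "semicycle_free (Suc r) (Hypergraph V E)"
    unfolding E_def
  proof (rule semicycle_free_Union)
    show "semicycle_free (Suc r) (Hypergraph V (F T))" if "T \<in> Ts" for T
      unfolding F_def
      by (rule semicycle_free_cone_transversals) (use r that ap_range[OF that] in \<open>auto simp: Ts_def\<close>)
  qed (use r F_sep in auto)
  \<comment> \<open>Indexing the two families by a Boolean lets the gluing lemma apply once
    more.\<close>
  have "semicycle_free (Suc r) (Hypergraph V (\<Union>b\<in>UNIV. if b then E else ?S))"
  proof (rule semicycle_free_Union)
    show "semicycle_free (Suc r) (Hypergraph V (if b then E else ?S))" for b
      using free_E semicycle_free_sunflower[of C "Suc r" V] C r by simp
    fix b b' :: bool and e f
    assume *: "e \<in> (if b then E else ?S)" "f \<in> (if b' then E else ?S)" "Suc r - 1 \<le> card (e \<inter> f)"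
    show "b = b'"
      using * ES[of e f] ES[of f e] by (cases b; cases b') (auto simp: Int_commute)
  qed (use r in simp)
  moreover have "(\<Union>b\<in>UNIV. if b then E else ?S) = E \<union> ?S" by (auto simp: UNIV_bool)
  ultimately have "semicycle_free (Suc r) ?H" by simp
  moreover have "chain_connected (Suc r) ?H"
    using C r by (intro chain_connected_sunflower[of V C]) (auto simp: V_def)
  moreover have "uniform_hypergraph (Suc r) ?H"
  proof -
    have "{..<M * m + N} \<subseteq> V" by (auto simp: V_def n)
    then show ?thesis using E_edge S_edge by (fastforce simp: uniform_hypergraph_def V_def)
  qed
  moreover have "card (E \<union> ?S) = N * m ^ r + (n - r)"
  proof -
    \<comment> \<open>An edge of both kinds would share \<open>r + 1\<close> vertices with
      itself.\<close>
    have "e \<notin> ?S" if "e \<in> E" for e using ES[OF that, of e] E_edge[OF that] by auto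
    then have "E \<inter> ?S = {}" by blast
    moreover have "finite ?S" by (simp add: sunflower_def V_def)
    moreover have "card ?S = n - r" using card_sunflower[of V C] C by (simp add: V_def)
    ultimately show ?thesis using card_E fin_E by (simp add: card_Un_disjoint)
  qed
  ultimately show ?thesis
    by (intro exI[of _ ?H]) (auto simp: hypertree_def V_def N_def m_def)
qed

lemma hypertree_star: "hypertree 2 (Hypergraph {..<i + 2} (sunflower {..<i + 2} {0 :: nat}))"
proof -
  have "uniform_hypergraph 2 (Hypergraph {..<i + 2} (sunflower {..<i + 2} {0 :: nat}))"
    by (auto simp: uniform_hypergraph_def sunflower_def card_insert_if)
  moreover have "{0} \<subset> {..<i + 2}" by (auto simp: psubset_eq set_eq_iff intro!: exI[of _ 1])
  ultimately show ?thesis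
    using semicycle_free_sunflower[of "{0::nat}" 2] chain_connected_sunflower[of "{..<i+2}" "{0}" 2]
    by (simp add: hypertree_def)
qed

section \<open>Asymptotic edge density\<close>

lemma tendsto_binomial_over_power:
  "(\<lambda>n. real (n choose r) / real n ^ r) \<longlonglongrightarrow> 1 / fact r"
proof -
  have one: "(\<lambda>n. (real n - real j) / real n) \<longlonglongrightarrow> 1" for j :: nat
  proof -
    have "(\<lambda>n. 1 - real j / real n) \<longlonglongrightarrow> 1 - 0"
      by (intro tendsto_intros lim_const_over_n)
    \<comment> \<open>At \<open>n = 0\<close> the right side is 0 by convention while the left is
      1.\<close>
    moreover have "eventually (\<lambda>n. 1 - real j / real n = (real n - real j) / real n) sequentially"
      using eventually_gt_at_top[of 0] by eventually_elim (simp add: diff_divide_distrib)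
    ultimately show ?thesis using Lim_transform_eventually by fastforce
  qed
  have "(\<lambda>n. (\<Prod>j<r. (real n - real j) / real n) / fact r) \<longlonglongrightarrow> (\<Prod>j<r. 1) / fact r"
    by (intro tendsto_divide tendsto_prod one tendsto_const) simp
  moreover have "(\<Prod>j<r. (real n - real j) / real n) / fact r = real (n choose r) / real n ^ r" for n
    by (simp add: binomial_gbinomial gbinomial_prod_rev prod_dividef atLeast0LessThan)
  ultimately show ?thesis by simp
qed

lemma strict_mono_tree_order: "strict_mono (\<lambda>i. tree_order r (Suc i))"
  unfolding strict_mono_Suc_iff
proof
  fix i
  have "Suc i * Suc i ^ r < Suc (Suc i) * Suc (Suc i) ^ r"
    by (rule mult_less_le_imp_less) (auto intro: power_mono)
  moreover have "(Suc i choose r) \<le> (Suc (Suc i) choose r)" by (rule binomial_right_mono) simp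
  ultimately show "tree_order r (Suc i) < tree_order r (Suc (Suc i))"
    by (simp add: tree_order_def)
qed

text \<open>With \<open>x = Suc i\<close>, the order \<open>n\<close> is asymptotic to
  \<open>x ^ Suc r\<close>. The cones contribute about \<open>x ^ r / fact r * (x ^ r) ^ r\<close>,
  hence about \<open>n ^ r / fact r\<close> edges, just as many as there are \<open>r\<close>-sets;
  the \<open>n - r\<close> sunflower edges are of lower order since \<open>r\<close> is at least
  2.\<close>

lemma edge_density_tendsto:
  assumes r: "r \<ge> 2"
  shows "(\<lambda>i. real ((Suc i choose r) * (Suc i ^ r) ^ r + (tree_order r (Suc i) - r)) /
           real (tree_order r (Suc i) choose r)) \<longlonglongrightarrow> 1"
proof -
  define n where "n i = tree_order r (Suc i)" for i
  define p where "p i = real (Suc i choose r) / real (Suc i) ^ r" for i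
  define q where "q i = real (n i choose r) / real (n i) ^ r" for i
  have mono: "strict_mono n" unfolding n_def by (rule strict_mono_tree_order)
  have p: "p \<longlonglongrightarrow> 1 / fact r"
    unfolding p_def by (rule LIMSEQ_Suc[OF tendsto_binomial_over_power])
  have q: "q \<longlonglongrightarrow> 1 / fact r"
    using LIMSEQ_subseq_LIMSEQ[OF tendsto_binomial_over_power[of r] mono] by (simp add: q_def[abs_def] o_def)
  have n_pos: "n i > 0" for i by (simp add: n_def tree_order_def)
  have inv: "(\<lambda>i. inverse (real (Suc i))) \<longlonglongrightarrow> 0" by (rule LIMSEQ_inverse_real_of_nat)
  \<comment> \<open>These are the three summands of \<open>tree_order\<close> divided by the first
    one.\<close>
  have "(\<lambda>i. 1 + p i * inverse (real (Suc i)) + real r * inverse (real (Suc i)) ^ Suc r)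
      \<longlonglongrightarrow> 1 + 1 / fact r * 0 + real r * 0 ^ Suc r"
    by (intro tendsto_intros p inv)
  moreover have "1 + p i * inverse (real (Suc i)) + real r * inverse (real (Suc i)) ^ Suc r
      = real (n i) / real (Suc i) ^ Suc r" for i
  proof -
    define x where "x = real (Suc i)"
    have "x > 0" by (simp add: x_def)
    moreover have "real (n i) = x * x ^ r + real (Suc i choose r) + real r"
      by (simp add: n_def tree_order_def x_def algebra_simps)
    ultimately show ?thesis
      unfolding p_def x_def[symmetric] by (simp add: field_simps)
  qed
  ultimately have "(\<lambda>i. real (n i) / real (Suc i) ^ Suc r) \<longlonglongrightarrow> 1" by simp
  then have "(\<lambda>i. inverse (real (n i) / real (Suc i) ^ Suc r)) \<longlonglongrightarrow> inverse 1"
    by (rule tendsto_inverse) simp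
  then have s: "(\<lambda>i. real (Suc i) ^ Suc r / real (n i)) \<longlonglongrightarrow> 1" by (simp del: of_nat_Suc power_Suc)
  have main: "(\<lambda>i. p i * (real (Suc i) ^ Suc r / real (n i)) ^ r / q i) \<longlonglongrightarrow> 1 / fact r * 1 ^ r / (1 / fact r)"
    by (intro tendsto_intros p q s) simp
  have ninv: "(\<lambda>i. inverse (real (n i))) \<longlonglongrightarrow> 0"
    using LIMSEQ_subseq_LIMSEQ[OF lim_inverse_n mono] by (simp add: o_def)
  have "(\<lambda>i. (inverse (real (n i)) ^ (r - 1) - real r * inverse (real (n i)) ^ r) / q i)
      \<longlonglongrightarrow> (0 ^ (r - 1) - real r * 0 ^ r) / (1 / fact r)"
    by (intro tendsto_intros ninv q) simp
  then have rest: "(\<lambda>i. (inverse (real (n i)) ^ (r - 1) - real r * inverse (real (n i)) ^ r) / q i) \<longlonglongrightarrow> 0"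
    using r by (simp add: power_0_left)
  \<comment> \<open>Dividing by \<open>n i ^ r\<close> splits the ratio into the cone edges and the
    sunflower edges.\<close>
  have "real ((Suc i choose r) * (Suc i ^ r) ^ r + (n i - r)) / real (n i choose r) =
      p i * (real (Suc i) ^ Suc r / real (n i)) ^ r / q i
      + (inverse (real (n i)) ^ (r - 1) - real r * inverse (real (n i)) ^ r) / q i" for i
  proof -
    have nr: "n i \<ge> r" by (simp add: n_def tree_order_def)
    define x where "x = real (Suc i)"
    define y where "y = real (n i)"
    have xy: "x > 0" "y > 0" using n_pos by (auto simp: x_def y_def)
    have "y ^ r = y * y ^ (r - 1)" using r by (cases r) auto
    then have A: "inverse y ^ (r - 1) - real r * inverse y ^ r = (y - real r) / y ^ r"
      using xy by (simp add: field_simps)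
    have "p i * (x ^ Suc r / y) ^ r = real (Suc i choose r) * (x ^ r) ^ r / y ^ r"
      using xy unfolding p_def x_def[symmetric] by (simp add: power_divide power_mult_distrib)
    moreover have "real ((Suc i choose r) * (Suc i ^ r) ^ r + (n i - r))
        = real (Suc i choose r) * (x ^ r) ^ r + (y - real r)"
      using nr by (simp add: x_def y_def of_nat_diff)
    ultimately show ?thesis
      using xy unfolding x_def[symmetric] y_def[symmetric] A q_def
      by (simp add: add_divide_distrib)
  qed
  then show ?thesis using tendsto_add[OF main rest] by (simp add: n_def)
qed

theorem theorem4:
  fixes k :: nat
  assumes "k \<ge> 2"
  shows "\<exists>H :: nat \<Rightarrow> nat hypergraph.
           (\<forall>i. hypertree k (H i)) \<and>
           strict_mono (\<lambda>i. card (verts (H i))) \<and>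
           (\<lambda>i. real (card (edges (H i))) / real (card (verts (H i)) choose (k - 1)))
             \<longlonglongrightarrow> 1"
proof (cases "k = 2")
  \<comment> \<open>For \<open>k = 2\<close> a sunflower with a one-point core is a star, and
    \<open>i + 2\<close> vertices give \<open>i + 1\<close> edges.\<close>
  case True
  define H where "H i = Hypergraph {..<i + 2} (sunflower {..<i + 2} {0 :: nat})" for i
  have edges: "card (edges (H i)) = Suc i" for i
    using card_sunflower[of "{..<i + 2}" "{0}"] by (simp add: H_def)
  have "(\<lambda>i. real (Suc i) / real (Suc (Suc i))) \<longlonglongrightarrow> 1"
    using LIMSEQ_Suc[OF LIMSEQ_n_over_Suc_n[where 'a = real]] by simp
  then show ?thesis
    using True hypertree_star edges
    by (intro exI[of _ H]) (auto simp: H_def strict_mono_def)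
next
  case False
  define r where "r = k - 1"
  have r: "r \<ge> 2" "k = Suc r" using assms False by (auto simp: r_def)
  have "\<forall>i. \<exists>H :: nat hypergraph. hypertree k H \<and> card (verts H) = tree_order r (Suc i) \<and>
      card (edges H) = (Suc i choose r) * (Suc i ^ r) ^ r + (tree_order r (Suc i) - r)"
    using exists_hypertree[OF r(1)] r(2) by simp
  then obtain H :: "nat \<Rightarrow> nat hypergraph" where H: "\<And>i. hypertree k (H i)"
      "\<And>i. card (verts (H i)) = tree_order r (Suc i)"
      "\<And>i. card (edges (H i)) = (Suc i choose r) * (Suc i ^ r) ^ r + (tree_order r (Suc i) - r)"
    by metis
  show ?thesis
    using H(1) strict_mono_tree_order edge_density_tendsto[OF r(1)]
    by (intro exI[of _ H]) (simp add: H(2,3) r(2))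
qed

end
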